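(* There is a family $\mathcal R$ of $64$ closed axis-parallel rectangles in the plane such that $\nu(\mathcal R)=16$ and $\tau(\mathcal R)\ge 32$. Consequently, $\tau(\mathcal R)>2\nu(\mathcal R)-1$.
   Context: For a finite family $\mathcal R$ of closed axis-parallel rectangles in the plane, $\nu(\mathcal R)$ is the maximum size of a pairwise disjoint subfamily, and $\tau(\mathcal R)$ is the minimum number of points of the plane such that every rectangle of $\mathcal R$ contains at least one of the points. *)

theory Defs
  imports Complex_Main
begin

(* Both side intervals are nondegenerate: segments and points are not rectangles. *)
definition closed_rectangle :: "(real \<times> real) set \<Rightarrow> bool" where
  "closed_rectangle R \<longleftrightarrow> (\<exists>a b c d. a < b \<and> c < d \<and> R = {a..b} \<times> {c..d})"

(* Meaningful for finite families only, as Max is unspecified on infinite sets. *)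
definition packing_number :: "'a set set \<Rightarrow> nat" where
  "packing_number F = Max {card S |S. S \<subseteq> F \<and> pairwise disjnt S}"

(* The set of admissible k is nonempty whenever F is a finite family of nonempty sets.
   Finiteness of P is required because card of an infinite set is 0. *)
definition piercing_number :: "'a set set \<Rightarrow> nat" where
  "piercing_number F =
     (LEAST k. \<exists>P. finite P \<and> card P = k \<and> (\<forall>R\<in>F. \<exists>p\<in>P. p \<in> R))"

end

theory Submission
  imports Defs
begin

text \<open>
  The rectangles live on a board of \<open>4 \<times> 4\<close> cells. Each of the four columns of the board is a strip
  that contains eight upright rectangles, its \<^emph>\<open>pieces\<close>; transposing the picture gives eight lying
  rectangles in each of the four rows. This makes \<open>2 \<cdot> 4 \<cdot> 8 = 64\<close> rectangles. A piece runs completely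
  through some consecutive cells of its strip and ends in the gaps between cells, so an upright and
  a lying piece that run through a common cell cross there, and pieces of different parallel strips
  are disjoint.

  Within a strip, five pieces meet in the pattern of a 5-cycle (two of them are wide and bridge the
  two lines on which the other three lie), two pieces are the overlapping halves of a third line,
  and one bar fills a fourth line alone. The point of this choice is
  \<open>card_le_card_cells\<close>: pairwise disjoint pieces of one strip number at most the cells through which
  at least one of them runs. In a pairwise disjoint subfamily no cell of the board is used both by
  an upright and by a lying piece. Summing over all eight strips therefore counts every cell at most
  once, and the subfamily has at most 16 members (\<open>card_disjoint_tiles_le\<close>). Four disjoint pieces in
  each column attain this.

  For the piercing number it is enough that no point lies in three of the rectangles
  (\<open>no_triple_point\<close>), since then every piercing set has at least \<open>64 / 2\<close> points. Two pieces of the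
  same strip overlap only over a gap between cells, which no crossing strip enters, and the pieces
  of one strip contain no three that meet pairwise.
\<close>

section \<open>Packing and piercing numbers\<close>

lemma packing_number_eqI:
  assumes "finite F"
    and "\<And>S. S \<subseteq> F \<Longrightarrow> pairwise disjnt S \<Longrightarrow> card S \<le> m"
    and "S \<subseteq> F" "pairwise disjnt S" "card S = m"
  shows "packing_number F = m"
proof -
  have "finite {card S |S. S \<subseteq> F \<and> pairwise disjnt S}"
    using finite_subset[of "{S. S \<subseteq> F \<and> pairwise disjnt S}" "Pow F"] assms(1) by auto
  then show ?thesis
    unfolding packing_number_def using assms by (intro Max_eqI) auto
qed

text \<open>Each point of a piercing set accounts for at most \<open>d\<close> members.\<close>

lemma card_le_depth_times_piercing_number:
  assumes "finite F" "{} \<notin> F"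
    and depth: "\<And>p. card {R \<in> F. p \<in> R} \<le> d"
  shows "card F \<le> d * piercing_number F"
proof -
  let ?pierces = "\<lambda>P k. finite P \<and> card P = k \<and> (\<forall>R\<in>F. \<exists>p\<in>P. p \<in> R)"
  have "\<forall>R\<in>F. \<exists>p. p \<in> R" using assms(2) by (metis all_not_in_conv)
  then obtain f where "\<forall>R\<in>F. f R \<in> R" by metis
  then have "?pierces (f ` F) (card (f ` F))" using assms(1) by blast
  \<comment> \<open>some finite set pierces \<open>F\<close>, so the least size is attained rather than a default value\<close>
  then have "\<exists>k P. ?pierces P k" by blast
  then have "\<exists>P. ?pierces P (piercing_number F)"
    unfolding piercing_number_def by (rule LeastI_ex)
  then obtain P where P: "?pierces P (piercing_number F)" by blast
  then have "F = (\<Union>p\<in>P. {R \<in> F. p \<in> R})" by blast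
  then have "card F \<le> (\<Sum>p\<in>P. card {R \<in> F. p \<in> R})"
    using card_UN_le P by metis
  also have "\<dots> \<le> card P * d"
    using sum_bounded_above[of P "\<lambda>p. card {R \<in> F. p \<in> R}" d] depth by simp
  finally show ?thesis using P by (simp add: mult.commute)
qed

section \<open>The pieces of a strip\<close>

text \<open>
  The five pieces \<open>Top\<close>, \<open>Upper\<close>, \<open>Lower\<close>, \<open>Bottom\<close>, \<open>Middle\<close> form the 5-cycle: \<open>Middle\<close> stands on one
  line, \<open>Lower\<close> and \<open>Upper\<close> on the next, and the wide pieces \<open>Bottom\<close> and \<open>Top\<close> reach over both lines.
\<close>

datatype piece = Top | Upper | Lower | Bottom | Middle | Upper_Half | Lower_Half | Bar

text \<open>
  Across the strip, coordinates are relative to its start at a multiple of 10, and all pieces stay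
  within \<open>[1, 8]\<close>. Along the strip, coordinates are absolute: cell number \<open>c\<close> is the range
  \<open>[10 c + 1, 10 c + 8]\<close> in which the crossing strip \<open>c\<close> has its pieces. Interior ends lie at 9, 10,
  19, 20, 29 or 30, inside the gaps, in such a way that consecutive pieces overlap by one unit.
\<close>

fun left right low high :: "piece \<Rightarrow> real" where
  "left Top = 1" | "left Upper = 3" | "left Lower = 3" | "left Bottom = 1"
| "left Middle = 1" | "left Upper_Half = 5" | "left Lower_Half = 5" | "left Bar = 7"
| "right Top = 4" | "right Upper = 4" | "right Lower = 4" | "right Bottom = 4"
| "right Middle = 2" | "right Upper_Half = 6" | "right Lower_Half = 6" | "right Bar = 8"
| "low Top = 29" | "low Upper = 19" | "low Lower = 9" | "low Bottom = 0"
| "low Middle = 9" | "low Upper_Half = 19" | "low Lower_Half = 0" | "low Bar = 0"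
| "high Top = 40" | "high Upper = 30" | "high Lower = 20" | "high Bottom = 10"
| "high Middle = 30" | "high Upper_Half = 40" | "high Lower_Half = 20" | "high Bar = 40"

text \<open>The cells through which a piece runs completely; it does not touch the range of any other.\<close>

fun cells :: "piece \<Rightarrow> nat set" where
  "cells Top = {3}" | "cells Upper = {2}" | "cells Lower = {1}" | "cells Bottom = {0}"
| "cells Middle = {1, 2}" | "cells Upper_Half = {2, 3}" | "cells Lower_Half = {0, 1}"
| "cells Bar = {0, 1, 2, 3}"

lemma cells_less: "c \<in> cells i \<Longrightarrow> c < 4"
  by (cases i) auto

lemma finite_cells: "finite (cells i)"
  by (cases i) auto

text \<open>
  The intersection pattern of the pieces of one strip, stated combinatorially; \<open>meet_iff\<close> below
  checks that the coordinates realize it.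
\<close>

fun meet :: "piece \<Rightarrow> piece \<Rightarrow> bool" where
  "meet Top j = (j \<in> {Upper, Middle})"
| "meet Upper j = (j \<in> {Top, Lower})"
| "meet Lower j = (j \<in> {Upper, Bottom})"
| "meet Bottom j = (j \<in> {Lower, Middle})"
| "meet Middle j = (j \<in> {Top, Bottom})"
| "meet Upper_Half j = (j = Lower_Half)"
| "meet Lower_Half j = (j = Upper_Half)"
| "meet Bar j = False"

lemma UNIV_piece:
  "UNIV = {Top, Upper, Lower, Bottom, Middle, Upper_Half, Lower_Half, Bar}"
  using piece.exhaust by auto

lemma finite_piece [simp]: "finite (A :: piece set)"
  by (rule finite_subset[OF subset_UNIV]) (simp add: UNIV_piece)

lemma card_piece: "card (UNIV :: piece set) = 8"
  by (simp add: UNIV_piece)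

text \<open>
  A pairwise disjoint set takes at most two pieces of the 5-cycle, one of the two halves, and the
  bar. With the bar all four cells are used. Without it the decisive fact is that two disjoint
  pieces of the 5-cycle run through exactly one cell of \<open>{0, 1}\<close> and one cell of \<open>{2, 3}\<close>, so that
  either half adds a new cell. The proof expands both cardinalities into sums of truth values.
\<close>

lemma card_le_card_cells:
  assumes indep: "\<And>i j. i \<in> J \<Longrightarrow> j \<in> J \<Longrightarrow> \<not> meet i j"
  shows "card J \<le> card (\<Union>i\<in>J. cells i)"
proof -
  have "(\<Union>i\<in>J. cells i) = {c \<in> {0, 1, 2, 3}. \<exists>i\<in>UNIV. i \<in> J \<and> c \<in> cells i}"
  proof -
    have "cells i \<subseteq> {0, 1, 2, 3}" for i by (cases i) auto
    then show ?thesis by blast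
  qed
  then have "card (\<Union>i\<in>J. cells i) = (\<Sum>c\<in>{0, 1, 2, 3}. of_bool (\<exists>i\<in>UNIV. i \<in> J \<and> c \<in> cells i))"
    by (simp add: of_bool_def flip: sum.inter_filter)
  moreover have "card J = (\<Sum>i\<in>UNIV. of_bool (i \<in> J))"
    by (simp add: of_bool_def flip: sum.inter_filter)
  ultimately show ?thesis
    using indep[of Top Upper] indep[of Top Middle] indep[of Upper Lower] indep[of Lower Bottom]
      indep[of Bottom Middle] indep[of Upper_Half Lower_Half]
    by (simp add: UNIV_piece of_bool_def split: if_splits)
qed

section \<open>The family\<close>

definition vertical :: "nat \<Rightarrow> piece \<Rightarrow> (real \<times> real) set" where
  "vertical X i = {10 * real X + left i .. 10 * real X + right i} \<times> {low i .. high i}"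

text \<open>
  The truth value tells upright from lying rectangles. The latter arise by transposition, and
  \<open>swap_in_tile\<close> then carries facts about upright rectangles over to lying ones.
\<close>

fun tile :: "bool \<times> nat \<times> piece \<Rightarrow> (real \<times> real) set" where
  "tile (True, X, i) = vertical X i"
| "tile (False, Y, i) = prod.swap -` vertical Y i"

abbreviation indices :: "(bool \<times> nat \<times> piece) set" where
  "indices \<equiv> UNIV \<times> {..<4} \<times> UNIV"

lemma piece_bounds:
  "1 \<le> left i" "left i < right i" "right i \<le> 8" "low i < high i"
  "right i - left i < high i - low i"
  by (cases i; simp)+

lemma piece_covers_cell: "c \<in> cells i \<Longrightarrow> low i \<le> 10 * real c + 1 \<and> 10 * real c + 8 \<le> high i"
  by (cases i) auto

lemma meet_iff:
  "meet i j \<longleftrightarrow> i \<noteq> j \<and> left i \<le> right j \<and> left j \<le> right i \<and> low i \<le> high j \<and> low j \<le> high i"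
  by (cases i; cases j; simp)

lemma meet_in_gap:
  assumes "meet i j" "low i \<le> y" "low j \<le> y" "y \<le> high i" "y \<le> high j"
  shows "y \<in> {9..10} \<union> {19..20} \<union> {29..30}"
  using assms by (cases i; cases j; simp)

lemma meet_triangle_free: "meet i j \<Longrightarrow> meet j k \<Longrightarrow> \<not> meet i k"
  by (cases i; cases j; cases k; simp)

lemma lying_tile:
  "tile (False, Y, i) = {low i .. high i} \<times> {10 * real Y + left i .. 10 * real Y + right i}"
  by (auto simp: vertical_def)

lemma closed_rectangle_tile: "closed_rectangle (tile k)"
proof -
  obtain v X i where k: "k = (v, X, i)" by (cases k)
  have "10 * real X + left i < 10 * real X + right i" "low i < high i"
    using piece_bounds[of i] by simp_all
  moreover have "tile k = {10 * real X + left i .. 10 * real X + right i} \<times> {low i .. high i} \<or>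
      tile k = {low i .. high i} \<times> {10 * real X + left i .. 10 * real X + right i}"
    unfolding k by (cases v) (simp_all only: lying_tile tile.simps(1) vertical_def simp_thms)
  ultimately show ?thesis unfolding closed_rectangle_def by blast
qed

lemma tiles_share_strip:
  assumes "p \<in> vertical X i" "p \<in> vertical X' j"
  shows "X = X'"
proof (rule ccontr)
  assume "X \<noteq> X'"
  then have "real X + 1 \<le> real X' \<or> real X' + 1 \<le> real X" by linarith
  then show False
    using assms piece_bounds[of i] piece_bounds[of j] by (auto simp: vertical_def)
qed

lemma vertical_meet:
  assumes "p \<in> vertical X i" "p \<in> vertical X j" "i \<noteq> j"
  shows "meet i j"
  using assms by (auto simp: meet_iff vertical_def)

lemma vertical_disjnt_meet:
  assumes "disjnt (vertical X i) (vertical X j)"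
  shows "\<not> meet i j"
proof
  assume "meet i j"
  then have "(10 * real X + max (left i) (left j), max (low i) (low j)) \<in> vertical X i \<inter> vertical X j"
    using piece_bounds[of i] piece_bounds[of j] by (auto simp: meet_iff vertical_def)
  then show False using assms by (auto simp: disjnt_def)
qed

lemma crossing_cell:
  assumes "Y \<in> cells i" "X \<in> cells j"
  shows "\<not> disjnt (tile (True, X, i)) (tile (False, Y, j))"
proof -
  have "(10 * real X + left i, 10 * real Y + left j) \<in> tile (True, X, i) \<inter> tile (False, Y, j)"
    using piece_bounds[of i] piece_bounds[of j] piece_covers_cell[OF assms(1)] piece_covers_cell[OF assms(2)]
    by (auto simp: vertical_def)
  then show ?thesis by (auto simp: disjnt_def)
qed

lemma swap_in_tile: "prod.swap p \<in> tile (v, X, i) \<longleftrightarrow> p \<in> tile (\<not> v, X, i)"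
  by (cases v) auto

text \<open>
  Two pieces of a strip overlap only over a gap between cells, while a lying rectangle stays within
  the range of a cell.
\<close>

lemma two_verticals_and_a_horizontal:
  assumes "p \<in> tile (True, X, i)" "p \<in> tile (True, X', j)" "p \<in> tile (False, Y, k)"
    and "Y < 4"
  shows "(X, i) = (X', j)"
proof -
  obtain x y where p: "p = (x, y)" by (cases p)
  have X: "X = X'" using tiles_share_strip assms by auto
  have "10 * real Y + 1 \<le> y" "y \<le> 10 * real Y + 8"
    using assms(3) piece_bounds[of k] by (auto simp: p vertical_def)
  moreover have "Y \<in> {0, 1, 2, 3}" using \<open>Y < 4\<close> by auto
  ultimately have "y \<notin> {9..10} \<union> {19..20} \<union> {29..30}" by auto
  then have "\<not> meet i j"
    using meet_in_gap[of i j y] assms(1,2) by (auto simp: p vertical_def)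
  then show ?thesis using vertical_meet assms(1,2) X by (metis tile.simps(1))
qed

lemma three_verticals:
  assumes "p \<in> tile (True, X, i)" "p \<in> tile (True, X', j)" "p \<in> tile (True, X'', k)"
  shows "(X, i) = (X', j) \<or> (X', j) = (X'', k) \<or> (X, i) = (X'', k)"
proof -
  have "X = X'" "X' = X''" using tiles_share_strip assms by auto
  then show ?thesis
    using vertical_meet meet_triangle_free assms by (metis tile.simps(1))
qed

text \<open>
  Among three rectangles two have the same direction. Transposing if necessary, these two are
  upright, and the two preceding lemmas cover both directions of the third.
\<close>

lemma no_triple_point:
  assumes "k1 \<in> indices" "k2 \<in> indices" "k3 \<in> indices"
    and "p \<in> tile k1" "p \<in> tile k2" "p \<in> tile k3"
  shows "k1 = k2 \<or> k2 = k3 \<or> k1 = k3"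
proof -
  obtain v1 X1 i1 v2 X2 i2 v3 X3 i3
    where k: "k1 = (v1, X1, i1)" "k2 = (v2, X2, i2)" "k3 = (v3, X3, i3)"
    by (metis prod_cases3)
  have swapped: "prod.swap p \<in> tile (\<not> v1, X1, i1)" "prod.swap p \<in> tile (\<not> v2, X2, i2)"
    "prod.swap p \<in> tile (\<not> v3, X3, i3)"
    using assms by (simp_all add: k swap_in_tile)
  show ?thesis
    using assms swapped two_verticals_and_a_horizontal three_verticals unfolding k
    by (cases v1; cases v2; cases v3; simp; blast)
qed

lemma inj_on_tile: "inj_on tile indices"
proof (rule inj_onI)
  fix k l assume eq: "tile k = tile l"
  obtain v X i w Y j where k: "k = (v, X, i)" and l: "l = (w, Y, j)"
    by (metis prod_cases3)
  have bounds: "10 * real X + left i \<le> 10 * real X + right i" "low i \<le> high i"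
    using piece_bounds[of i] by simp_all
  have same: "(X, i) = (Y, j)" if "vertical X i = vertical Y j"
  proof -
    have "(10 * real X + left i, low i) \<in> vertical X i"
      using bounds by (simp add: vertical_def)
    then have "X = Y" using tiles_share_strip that by blast
    then have "left i = left j" "right i = right j" "low i = low j" "high i = high j"
      using that bounds by (auto simp: vertical_def times_eq_iff)
    then have "i = j" by (cases i; cases j; simp)
    with \<open>X = Y\<close> show ?thesis by simp
  qed
  show "k = l"
  proof (cases "v = w")
    case True
    have "vertical X i = vertical Y j"
      using eq True by (cases w) (auto simp: k l set_eq_iff)
    then show ?thesis using same True by (simp add: k l)
  next
    case False
    \<comment> \<open>impossible: an upright tile is taller than wide, a lying one wider than tall\<close>
    have "vertical X i = tile (False, Y, j)"
      using eq False by (cases v) (auto simp: k l set_eq_iff)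
    then have "{10 * real X + left i .. 10 * real X + right i} \<times> {low i .. high i} =
        {low j .. high j} \<times> {10 * real Y + left j .. 10 * real Y + right j}"
      unfolding lying_tile vertical_def .
    then have "right i - left i = high j - low j" "high i - low i = right j - left j"
      using bounds by (auto simp: times_eq_iff)
    then show ?thesis using piece_bounds(5)[of i] piece_bounds(5)[of j] by simp
  qed
qed

section \<open>Disjoint subfamilies\<close>

lemma disjnt_tiles_not_meet:
  assumes "disjnt (tile (v, X, i)) (tile (v, X, j))"
  shows "\<not> meet i j"
proof -
  have "disjnt (vertical X i) (vertical X j)"
    using assms by (cases v) (auto simp: disjnt_iff)
  then show ?thesis by (rule vertical_disjnt_meet)
qed

text \<open>
  The board is counted by cells: \<open>C True X\<close> are the cells of column \<open>X\<close> used by upright members of \<open>S\<close>,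
  \<open>C False Y\<close> those of row \<open>Y\<close> used by lying members. Both kinds of used cells, placed on the board,
  form disjoint sets because rectangles that run through a common cell cross.
\<close>

lemma card_disjoint_tiles_le:
  assumes S: "S \<subseteq> tile ` indices" and disj: "pairwise disjnt S"
  shows "card S \<le> 16"
proof -
  define A where "A = {k \<in> indices. tile k \<in> S}"
  define J where "J v X = {i. (v, X, i) \<in> A}" for v X
  define C where "C v X = (\<Union>i\<in>J v X. cells i)" for v X
  have disjA: "disjnt (tile k) (tile l)" if "k \<in> A" "l \<in> A" "k \<noteq> l" for k l
    using that disj inj_onD[OF inj_on_tile, of k l] unfolding A_def pairwise_def by blast
  have "S = tile ` A" using S unfolding A_def by blast
  moreover have "inj_on tile A" by (rule inj_on_subset[OF inj_on_tile]) (auto simp: A_def)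
  ultimately have "card S = card A" by (simp add: card_image)
  also have "A = (SIGMA v:UNIV. SIGMA X:{..<4}. J v X)" by (auto simp: A_def J_def)
  also have "card \<dots> = (\<Sum>v\<in>UNIV. \<Sum>X<4. card (J v X))" by simp
  also have "\<dots> \<le> (\<Sum>v\<in>UNIV. \<Sum>X<4. card (C v X))"
  proof (intro sum_mono)
    fix v and X :: nat
    have "\<not> meet i j" if "i \<in> J v X" "j \<in> J v X" for i j
      using that disjA[of "(v, X, i)" "(v, X, j)"] disjnt_tiles_not_meet
      by (cases "i = j") (auto simp: J_def meet_iff)
    then show "card (J v X) \<le> card (C v X)"
      unfolding C_def by (rule card_le_card_cells)
  qed
  also have "\<dots> = card (SIGMA X:{..<4}. C True X) + card (prod.swap ` (SIGMA Y:{..<4}. C False Y))"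
    by (simp add: UNIV_bool card_image C_def finite_cells)
  also have "\<dots> = card ((SIGMA X:{..<4}. C True X) \<union> prod.swap ` (SIGMA Y:{..<4}. C False Y))"
  proof (intro card_Un_disjoint[symmetric])
    show "(SIGMA X:{..<4}. C True X) \<inter> prod.swap ` (SIGMA Y:{..<4}. C False Y) = {}"
    proof (rule ccontr)
      assume "\<not> ?thesis"
      then obtain X Y where "Y \<in> C True X" "X \<in> C False Y" by auto
      then obtain i j where "(True, X, i) \<in> A" "Y \<in> cells i" "(False, Y, j) \<in> A" "X \<in> cells j"
        by (auto simp: C_def J_def)
      then show False using crossing_cell disjA by blast
    qed
  qed (auto simp: C_def finite_cells)
  also have "\<dots> \<le> card ({..<4::nat} \<times> {..<4::nat})"
    using cells_less by (intro card_mono) (auto simp: C_def)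
  finally show ?thesis by simp
qed

lemma packing_number_tiles: "packing_number (tile ` indices) = 16"
proof (rule packing_number_eqI)
  let ?A = "{True} \<times> {..<4::nat} \<times> {Top, Bottom, Upper_Half, Bar}"
  show "finite (tile ` indices)" by simp
  show "card S \<le> 16" if "S \<subseteq> tile ` indices" "pairwise disjnt S" for S
    using card_disjoint_tiles_le that .
  show "tile ` ?A \<subseteq> tile ` indices" by auto
  show "pairwise disjnt (tile ` ?A)"
  proof (intro pairwise_imageI)
    fix k l assume kl: "k \<in> ?A" "l \<in> ?A" "k \<noteq> l"
    then obtain X i Y j where eq: "k = (True, X, i)" "l = (True, Y, j)"
      and ij: "i \<in> {Top, Bottom, Upper_Half, Bar}" "j \<in> {Top, Bottom, Upper_Half, Bar}"
      by blast
    have "\<not> meet i j" using ij by auto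
    then have "\<not> (p \<in> vertical X i \<and> p \<in> vertical Y j)" for p
      using tiles_share_strip[of p X i Y j] vertical_meet[of p X i j] kl(3) unfolding eq by blast
    then show "disjnt (tile k) (tile l)" unfolding eq disjnt_iff by simp
  qed
  have "inj_on tile ?A" by (rule inj_on_subset[OF inj_on_tile]) auto
  then show "card (tile ` ?A) = 16" by (simp add: card_image card_cartesian_product)
qed

section \<open>The counterexample\<close>

lemma tiles_depth: "card {R \<in> tile ` indices. p \<in> R} \<le> 2"
proof (rule ccontr)
  assume "\<not> ?thesis"
  then have "3 \<le> card {R \<in> tile ` indices. p \<in> R}" by simp
  then obtain T where T: "T \<subseteq> {R \<in> tile ` indices. p \<in> R}" "card T = 3"
    by (rule obtain_subset_with_card_n)
  then obtain R1 R2 R3 where R: "T = {R1, R2, R3}" and distinct: "R1 \<noteq> R2" "R2 \<noteq> R3" "R1 \<noteq> R3"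
    unfolding card_3_iff by blast
  have p: "p \<in> R1" "p \<in> R2" "p \<in> R3"
    using T(1) R by auto
  have "R1 \<in> tile ` indices" "R2 \<in> tile ` indices" "R3 \<in> tile ` indices"
    using T(1) unfolding R by (simp_all del: mem_Sigma_iff)
  then show False
  proof (elim imageE)
    fix k1 k2 k3
    assume k: "k1 \<in> indices" "k2 \<in> indices" "k3 \<in> indices"
      and eq: "R1 = tile k1" "R2 = tile k2" "R3 = tile k3"
    have "k1 = k2 \<or> k2 = k3 \<or> k1 = k3"
      by (rule no_triple_point[OF k p[unfolded eq]])
    then show False using distinct eq by blast
  qed
qed

theorem theorem1:
  "\<exists>F :: (real \<times> real) set set.
     card F = 64 \<and> (\<forall>R\<in>F. closed_rectangle R) \<and>
     packing_number F = 16 \<and> piercing_number F \<ge> 32 \<and>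
     int (piercing_number F) > 2 * int (packing_number F) - 1"
proof -
  let ?F = "tile ` indices"
  have "card ?F = card indices" by (rule card_image[OF inj_on_tile])
  also have "\<dots> = 64" by (simp only: card_cartesian_product card_piece card_UNIV_bool card_lessThan)
  finally have card: "card ?F = 64" .
  have rect: "\<forall>R\<in>?F. closed_rectangle R" using closed_rectangle_tile by blast
  moreover have "closed_rectangle R \<Longrightarrow> R \<noteq> {}" for R by (auto simp: closed_rectangle_def)
  ultimately have "{} \<notin> ?F" by blast
  then have "card ?F \<le> 2 * piercing_number ?F"
    using tiles_depth by (intro card_le_depth_times_piercing_number) simp_all
  then have "piercing_number ?F \<ge> 32" using card by simp
  then show ?thesis using card rect packing_number_tiles by (intro exI[of _ ?F]) simp
qed

end
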